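(* Let $\mathcal{A}\in\mathbb{C}_{t}^{n,n}$. (1) If $\mathcal{A}$ is a T-idempotent tensor, then $\mathcal{A}$ is an order $t$ $\{2\}$ inverse of itself. (2) If $\mathcal{A}$ is both an idempotent tensor and a T-idempotent tensor, then $\mathcal{A}$ is an order $t$ $\{1\}$ inverse of itself, and $\mathcal{A}\cdot(b^{[\frac{1}{(t-1)^2}]})^{t-1}$ is a solution of the equation $\mathcal{A}\cdot x^{t-1}=b$ in the unknown $x\in\mathbb{C}^n$ whenever this equation is solvable ($b\in\mathbb{C}^n$).
   Context: $[n]=\{1,\ldots,n\}$. $\mathbb{C}_{t}^{n,n}$ is the set of all order $t$ complex tensors $\mathcal{A}=(a_{i_1\cdots i_t})$ of dimension $n\times n\times\cdots\times n$. For $x\in\mathbb{C}^n$, $\mathcal{A}\cdot x^{t-1}\in\mathbb{C}^n$ has components $(\mathcal{A}\cdot x^{t-1})_i=\sum_{i_2,\ldots,i_t\in[n]}a_{ii_2\cdots i_t}x_{i_2}\cdots x_{i_t}$. For a vector $x$, $x^{[r]}=(x_1^r,\ldots,x_n^r)^{\mathrm T}$ (componentwise power; for $r=1/s$ this is the componentwise $s$-th root, no branch being specified in the paper). General tensor product: for $\mathcal{A}\in\mathbb{C}_t^{n,n}$, $\mathcal{B}\in\mathbb{C}_k^{n,n}$, $\mathcal{A}\mathcal{B}\in\mathbb{C}_{(t-1)(k-1)+1}^{n,n}$ has entries $(\mathcal{A}\mathcal{B})_{i\alpha_1\cdots\alpha_{t-1}}=\sum_{i_2,\ldots,i_t\in[n]}a_{ii_2\cdots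 i_t}b_{i_2\alpha_1}\cdots b_{i_t\alpha_{t-1}}$, $i\in[n]$, $\alpha_1,\ldots,\alpha_{t-1}\in[n]^{k-1}$; $\mathcal{A}^2=\mathcal{A}\mathcal{A}$. $\mathcal{A}$ is a T-idempotent tensor if $\mathcal{A}^2\cdot(y^{[\frac{1}{t-1}]})^{(t-1)^2}=\mathcal{A}\cdot y^{t-1}$ for all $y\in\mathbb{C}^n$. $\mathcal{A}$ is an idempotent tensor if $\mathcal{A}\cdot[(\mathcal{A}\cdot y^{t-1})^{[\frac{1}{t-1}]}]^{t-1}=\mathcal{A}\cdot y^{t-1}$ for all $y\in\mathbb{C}^n$. For $\mathcal{X}\in\mathbb{C}_k^{n,n}$ and $s=(t-1)(k-1)$: $\mathcal{X}$ is an order $k$ $\{1\}$ inverse of $\mathcal{A}$ if $\mathcal{A}\mathcal{X}\cdot[(\mathcal{A}\cdot y^{t-1})^{[\frac1s]}]^s=\mathcal{A}\cdot y^{t-1}$ for all $y\in\mathbb{C}^n$; $\mathcal{X}$ is an order $k$ $\{2\}$ inverse of $\mathcal{A}$ if $\mathcal{X}\mathcal{A}\mathcal{X}\cdot(y^{[\frac1s]})^{s(k-1)}=\mathcal{X}\cdot y^{k-1}$ for all $y\in\mathbb{C}^n$. *)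

theory Defs
  imports "HOL-Analysis.Analysis"
begin

text \<open>The index set [n] is a finite type \<open>'n\<close>. A tensor maps an index tuple, given as a list, to
  an entry; as the order is not part of the type, an order \<open>t\<close> tensor is required to vanish on
  lists of any other length.\<close>

type_synonym 'n tensor = "'n list \<Rightarrow> complex"

definition tensors :: "nat \<Rightarrow> 'n tensor set" where
  "tensors t = {A. \<forall>is. length is \<noteq> t \<longrightarrow> A is = 0}"

text \<open>\<open>tensor_app A x m\<close> is the vector \<open>A \<cdot> x\<^sup>m\<close>, where \<open>A\<close> has order \<open>m + 1\<close>.\<close>

definition tensor_app :: "'n::finite tensor \<Rightarrow> complex ^ 'n \<Rightarrow> nat \<Rightarrow> complex ^ 'n" where
  "tensor_app A x m = (\<chi> i. \<Sum>js | length js = m. A (i # js) * (\<Prod>j\<leftarrow>js. x $ j))"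

text \<open>The general product of an order \<open>t\<close> tensor \<open>A\<close> and an order \<open>k\<close> tensor \<open>B\<close>. The entry index
  is \<open>i # as\<close>, where \<open>as\<close> is the concatenation of \<open>t - 1\<close> blocks of length \<open>k - 1\<close>.\<close>

definition tensor_prod :: "nat \<Rightarrow> nat \<Rightarrow> 'n::finite tensor \<Rightarrow> 'n tensor \<Rightarrow> 'n tensor" where
  "tensor_prod t k A B = (\<lambda>is.
     if length is = (t - 1) * (k - 1) + 1
     then let i = hd is; as = tl is in
       \<Sum>js | length js = t - 1.
         A (i # js) * (\<Prod>m<t - 1. B (js ! m # take (k - 1) (drop (m * (k - 1)) as)))
     else 0)"

text \<open>A fixed but arbitrary choice \<open>rt s z\<close> of \<open>z\<close> to the power \<open>1/s\<close> for all \<open>s > 0\<close>. The second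
  condition is the power law \<open>(z\<^bsup>1/a\<^esup>)\<^bsup>1/b\<^esup> = z\<^bsup>1/(ab)\<^esup>\<close>; without it, roots of different orders
  would be unrelated to each other.\<close>

definition root_branch :: "(nat \<Rightarrow> complex \<Rightarrow> complex) \<Rightarrow> bool" where
  "root_branch rt \<longleftrightarrow>
     (\<forall>s z. s > 0 \<longrightarrow> rt s z ^ s = z) \<and>
     (\<forall>a b z. a > 0 \<longrightarrow> b > 0 \<longrightarrow> rt b (rt a z) = rt (a * b) z)"

lemma root_branch_principal: "root_branch (\<lambda>s z. z powr (1 / of_nat s))"
  unfolding root_branch_def
proof (intro conjI allI impI)
  fix s :: nat and z :: complex
  assume "s > 0"
  then show "(z powr (1 / of_nat s)) ^ s = z"
    by (cases "z = 0") (auto simp: powr_def exp_of_nat_mult [symmetric])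
next
  fix a b :: nat and z :: complex
  assume a: "a > 0" and b: "b > 0"
  show "(z powr (1 / of_nat a)) powr (1 / of_nat b) = z powr (1 / of_nat (a * b))"
  proof (cases "z = 0")
    case False
    have bound: "- pi < Im (Ln z) / real a" "Im (Ln z) / real a \<le> pi"
    proof -
      have "- pi * real a \<le> - pi" "pi \<le> pi * real a"
        using a pi_gt_zero by auto
      with mpi_less_Im_Ln [OF False] Im_Ln_le_pi [OF False]
      have "- pi * real a < Im (Ln z)" "Im (Ln z) \<le> pi * real a"
        by linarith+
      then show "- pi < Im (Ln z) / real a" "Im (Ln z) / real a \<le> pi"
        using a by (simp_all add: field_simps)
    qed
    have "Ln (exp (Ln z / of_nat a)) = Ln z / of_nat a"
      by (rule Ln_exp) (use bound in simp_all)
    with False show ?thesis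
      by (simp add: powr_def field_simps)
  qed simp
qed

definition root_vec :: "(nat \<Rightarrow> complex \<Rightarrow> complex) \<Rightarrow> nat \<Rightarrow> complex ^ 'n \<Rightarrow> complex ^ 'n" where
  "root_vec rt s x = (\<chi> i. rt s (x $ i))"

definition T_idempotent ::
    "(nat \<Rightarrow> complex \<Rightarrow> complex) \<Rightarrow> nat \<Rightarrow> 'n::finite tensor \<Rightarrow> bool" where
  "T_idempotent rt t A \<longleftrightarrow> A \<in> tensors t \<and>
     (\<forall>y. tensor_app (tensor_prod t t A A) (root_vec rt (t - 1) y) ((t - 1)\<^sup>2) =
          tensor_app A y (t - 1))"

definition idempotent_tensor ::
    "(nat \<Rightarrow> complex \<Rightarrow> complex) \<Rightarrow> nat \<Rightarrow> 'n::finite tensor \<Rightarrow> bool" where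
  "idempotent_tensor rt t A \<longleftrightarrow> A \<in> tensors t \<and>
     (\<forall>y. tensor_app A (root_vec rt (t - 1) (tensor_app A y (t - 1))) (t - 1) =
          tensor_app A y (t - 1))"

text \<open>\<open>X\<close> is an order \<open>k\<close> \<open>{1}\<close> (respectively \<open>{2}\<close>) inverse of the order \<open>t\<close> tensor \<open>A\<close>. The
  product \<open>XA\<close> has order \<open>s + 1\<close>.\<close>

definition one_inverse ::
    "(nat \<Rightarrow> complex \<Rightarrow> complex) \<Rightarrow> nat \<Rightarrow> 'n::finite tensor \<Rightarrow> nat \<Rightarrow> 'n tensor \<Rightarrow> bool" where
  "one_inverse rt t A k X \<longleftrightarrow> A \<in> tensors t \<and> X \<in> tensors k \<and>
     (let s = (t - 1) * (k - 1) in
       \<forall>y. tensor_app (tensor_prod t k A X) (root_vec rt s (tensor_app A y (t - 1))) s =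
           tensor_app A y (t - 1))"

definition two_inverse ::
    "(nat \<Rightarrow> complex \<Rightarrow> complex) \<Rightarrow> nat \<Rightarrow> 'n::finite tensor \<Rightarrow> nat \<Rightarrow> 'n tensor \<Rightarrow> bool" where
  "two_inverse rt t A k X \<longleftrightarrow> A \<in> tensors t \<and> X \<in> tensors k \<and>
     (let s = (t - 1) * (k - 1) in
       \<forall>y. tensor_app (tensor_prod (s + 1) k (tensor_prod k t X A) X) (root_vec rt s y)
             (s * (k - 1)) =
           tensor_app X y (k - 1))"

end

theory Submission
  imports Defs
begin

text \<open>Write \<open>f x = A \<cdot> x\<^sup>m\<close> and \<open>r\<close> for the componentwise \<open>m\<close>-th root, with \<open>m = t - 1\<close>. The tensor
  product corresponds to composition, so T-idempotence says \<open>f \<circ> f \<circ> r = f\<close> and idempotence says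
  \<open>f \<circ> r \<circ> f = f\<close>, while the power law makes the componentwise \<open>m\<^sup>2\<close>-th root equal to \<open>r \<circ> r\<close>.
  All three claims are then formal: \<open>f \<circ> f \<circ> f \<circ> r \<circ> r = f \<circ> f \<circ> r = f\<close> and
  \<open>f \<circ> f \<circ> r \<circ> r \<circ> f = f \<circ> r \<circ> f = f\<close>.\<close>

lemma sum_lists_length_add:
  fixes g :: "'a::finite list \<Rightarrow> 'b::comm_monoid_add"
  shows "(\<Sum>as | length as = p + n. g as) =
    (\<Sum>us | length us = p. \<Sum>vs | length vs = n. g (us @ vs))"
proof -
  have "(\<Sum>as | length as = p + n. g as) =
      (\<Sum>(us, vs) \<in> {us. length us = p} \<times> {vs. length vs = n}. g (us @ vs))"
    by (rule sum.reindex_bij_witness[where i = "\<lambda>(us, vs). us @ vs"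
          and j = "\<lambda>as. (take p as, drop p as)"]) auto
  then show ?thesis
    by (simp add: sum.cartesian_product)
qed

text \<open>This is distributivity: expanding the product of the \<open>length js\<close> sums on
  the right chooses one block of length \<open>p\<close> per factor, and \<open>as\<close> is the
  concatenation of these blocks. The induction peels off the first block.\<close>

lemma sum_blocks_eq_prod_tensor_app:
  fixes B :: "'n::finite tensor"
  shows "(\<Sum>as | length as = length js * p.
      (\<Prod>q<length js. B (js ! q # take p (drop (q * p) as))) * (\<Prod>j\<leftarrow>as. x $ j)) =
    (\<Prod>j\<leftarrow>js. tensor_app B x p $ j)"
proof (induction js)
  case (Cons i js)
  let ?P = "\<lambda>vs. (\<Prod>q<length js. B (js ! q # take p (drop (q * p) vs)))"
  \<comment> \<open>The factor \<open>q = 0\<close> reads exactly \<open>us\<close>; for later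
    factors, dropping \<open>us\<close> lowers the offset by \<open>p\<close>, which leaves the
    blocks of \<open>vs\<close>.\<close>
  have split: "(\<Prod>q<length (i # js). B ((i # js) ! q # take p (drop (q * p) (us @ vs)))) =
      B (i # us) * ?P vs" if "length us = p" for us vs
    using that by (simp add: prod.lessThan_Suc_shift del: prod.lessThan_Suc)
  have "(\<Sum>as | length as = length (i # js) * p.
      (\<Prod>q<length (i # js). B ((i # js) ! q # take p (drop (q * p) as))) * (\<Prod>j\<leftarrow>as. x $ j)) =
      (\<Sum>us | length us = p. \<Sum>vs | length vs = length js * p.
        (B (i # us) * (\<Prod>j\<leftarrow>us. x $ j)) * (?P vs * (\<Prod>j\<leftarrow>vs. x $ j)))"
    unfolding length_Cons mult_Suc sum_lists_length_add
  proof (intro sum.cong refl)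
    fix us vs :: "'n list" assume "us \<in> {us. length us = p}"
    then have "length us = p" by simp
    from split[OF this, of vs, unfolded length_Cons]
    show "(\<Prod>q<Suc (length js). B ((i # js) ! q # take p (drop (q * p) (us @ vs)))) *
        (\<Prod>j\<leftarrow>us @ vs. x $ j) =
        (B (i # us) * (\<Prod>j\<leftarrow>us. x $ j)) * (?P vs * (\<Prod>j\<leftarrow>vs. x $ j))"
      by (simp only:) simp
  qed
  also have "\<dots> = tensor_app B x p $ i * (\<Prod>j\<leftarrow>js. tensor_app B x p $ j)"
    by (simp add: sum_product[symmetric] Cons.IH) (simp add: tensor_app_def)
  finally show ?case by simp
qed simp

lemma tensor_app_tensor_prod:
  fixes A B :: "'n::finite tensor"
  shows "tensor_app (tensor_prod t k A B) x ((t - 1) * (k - 1)) =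
    tensor_app A (tensor_app B x (k - 1)) (t - 1)"
proof (rule vec_eq_iff[THEN iffD2], rule allI)
  fix i
  let ?P = "\<lambda>js as. (\<Prod>q<t - 1. B (js ! q # take (k - 1) (drop (q * (k - 1)) as)))"
  let ?X = "\<lambda>as. \<Prod>j\<leftarrow>as. x $ j"
  have "tensor_app (tensor_prod t k A B) x ((t - 1) * (k - 1)) $ i =
      (\<Sum>as | length as = (t - 1) * (k - 1). \<Sum>js | length js = t - 1.
        A (i # js) * (?P js as * ?X as))"
    unfolding tensor_app_def tensor_prod_def
    by (simp add: Let_def sum_distrib_right mult.assoc)
  \<comment> \<open>With \<open>js\<close> fixed on the outside, the inner sum over
    \<open>as\<close> factorises block by block.\<close>
  also have "\<dots> = (\<Sum>js | length js = t - 1.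
      A (i # js) * (\<Sum>as | length as = (t - 1) * (k - 1). ?P js as * ?X as))"
    by (subst sum.swap) (simp add: sum_distrib_left)
  also have "\<dots> = (\<Sum>js | length js = t - 1.
      A (i # js) * (\<Prod>j\<leftarrow>js. tensor_app B x (k - 1) $ j))"
  proof (intro sum.cong refl)
    fix js :: "'n list" assume "js \<in> {js. length js = t - 1}"
    then have "length js = t - 1" by simp
    from sum_blocks_eq_prod_tensor_app[where js = js and p = "k - 1" and B = B and x = x, unfolded this]
    show "A (i # js) * (\<Sum>as | length as = (t - 1) * (k - 1). ?P js as * ?X as) =
        A (i # js) * (\<Prod>j\<leftarrow>js. tensor_app B x (k - 1) $ j)"
      by (rule arg_cong)
  qed
  finally show "tensor_app (tensor_prod t k A B) x ((t - 1) * (k - 1)) $ i =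
      tensor_app A (tensor_app B x (k - 1)) (t - 1) $ i"
    by (simp add: tensor_app_def)
qed

lemma root_vec_mult:
  assumes "root_branch rt" "a > 0" "b > 0"
  shows "root_vec rt (a * b) x = root_vec rt b (root_vec rt a x)"
  using assms by (simp add: root_branch_def root_vec_def)

theorem proposition3p3:
  fixes A :: "'n::finite tensor" and t :: nat and rt :: "nat \<Rightarrow> complex \<Rightarrow> complex"
  assumes "t \<ge> 2" and "A \<in> tensors t" and "root_branch rt"
  shows "(T_idempotent rt t A \<longrightarrow> two_inverse rt t A t A) \<and>
    (idempotent_tensor rt t A \<and> T_idempotent rt t A \<longrightarrow>
       one_inverse rt t A t A \<and>
       (\<forall>b :: complex ^ 'n. (\<exists>x. tensor_app A x (t - 1) = b) \<longrightarrow>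
          tensor_app A (tensor_app A (root_vec rt ((t - 1)\<^sup>2) b) (t - 1)) (t - 1) = b))"
proof -
  define f where "f x = tensor_app A x (t - 1)" for x
  define r :: "complex ^ 'n \<Rightarrow> complex ^ 'n" where "r = root_vec rt (t - 1)"
  \<comment> \<open>The power law needs positive root orders; \<open>t \<ge> 2\<close> supplies
    \<open>t - 1 > 0\<close>.\<close>
  have rr: "root_vec rt ((t - 1) * (t - 1)) y = r (r y)" for y
    using assms by (simp add: r_def root_vec_mult)
  have AA: "tensor_app (tensor_prod t t A A) x ((t - 1) * (t - 1)) = f (f x)" for x
    unfolding f_def by (rule tensor_app_tensor_prod)
  \<comment> \<open>The product of \<open>A\<close> with itself has order
    \<open>(t - 1) * (t - 1) + 1\<close>, so the composition lemma applies it with exponent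
    \<open>(t - 1) * (t - 1)\<close>, which is the case covered by \<open>AA\<close>.\<close>
  have AAA: "tensor_app (tensor_prod ((t - 1) * (t - 1) + 1) t (tensor_prod t t A A) A) x
      ((t - 1) * (t - 1) * (t - 1)) = f (f (f x))" for x
    using tensor_app_tensor_prod[of "(t - 1) * (t - 1) + 1" t "tensor_prod t t A A" A x] AA
    by (simp add: f_def)
  have T: "f (f (r y)) = f y" if "T_idempotent rt t A" for y
    using that unfolding T_idempotent_def power2_eq_square AA by (simp add: f_def r_def)
  have I: "f (r (f y)) = f y" if "idempotent_tensor rt t A" for y
    using that by (simp add: idempotent_tensor_def f_def r_def)
  \<comment> \<open>For solvable \<open>b\<close>, writing \<open>b = f x\<close> turns the last
    claim into the same identity as the {1} inverse: \<open>T\<close> at \<open>r (f x)\<close>,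
    then \<open>I\<close> at \<open>x\<close>.\<close>
  show ?thesis
    unfolding two_inverse_def one_inverse_def Let_def power2_eq_square AA AAA rr f_def[symmetric]
    using assms T I by auto
qed

end
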